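(* Let $\mathbf{x}=(x_1,x_2,x_3)$ be the triple of indeterminates of $\mathbb{Q}(x_1,x_2,x_3)$, let $\Delta=\begin{bmatrix}0&1&-1\\-1&0&1\\1&-1&0\end{bmatrix}$, and let $D=2I_3=\mathrm{diag}(2,2,2)$. Consider the generalized cluster pattern $CP_{(\mathbf{x},\Delta,2I_3)}$ with initial seed $(\mathbf{x},\Delta)$ at the rooted vertex $t_0$. Then the restriction of $CP_{(\mathbf{x},\Delta,2I_3)}$ to $\mathbb{T}'_3$, with the substitution $x_1=x_2=x_3=1$ and ignoring exchange matrices (i.e. keeping only the clusters), gives the tree $\mathbb{T}$: assigning to each vertex $t$ of $\mathbb{T}'_3$ (rooted at $t_0$) the cluster at $t$ evaluated at $x_1=x_2=x_3=1$ yields exactly the rooted tree of triples $\mathbb{T}$.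
   Context: Generalized cluster patterns. Let $n\ge 0$ be an integer and $\mathcal{F}$ a rational function field in $n$ indeterminates. A labeled seed is a pair $(\mathbf{x},B)$, where $\mathbf{x}=(x_1,\dots,x_n)$ (the cluster) is an $n$-tuple of elements of $\mathcal{F}$ forming a free generating set of $\mathcal{F}$, and $B=(b_{ij})$ (the exchange matrix) is an $n\times n$ integer skew-symmetrizable matrix (there is a positive integer diagonal matrix $S$ with $SB$ skew-symmetric). Fix a positive integer diagonal matrix $D=\mathrm{diag}(d_1,\dots,d_n)$. Write $[b]_+=\max(b,0)$. For $k\in\{1,\dots,n\}$ the seed mutation $\mu_k$ in direction $k$ sends $(\mathbf{x},B)$ to $(\mathbf{x}',B')$, where $b'_{ij}=-b_{ij}$ if $i=k$ or $j=k$, and $b'_{ij}=b_{ij}+d_k\left([b_{ik}]_+b_{kj}+b_{ik}[-b_{kj}]_+\right)$ otherwise; and $x'_j=x_j$ for $j\ne k$, while $$x'_k=\frac{\left(\prod_{i=1}^n x_i^{[-b_{ik}]_+}\right)^{d_k}\sum_{s=0}^{d_k}\left(\prod_{i=1}^n x_i^{b_{ik}}\right)^s}{x_k}.$$ Let $\mathbb{T}_n$ be the $n$-regular tree whose edges are labeled by $1,\dots,n$ so that the $n$ edges at each vertex have different labels, and fix a vertex $t_0$ (the rooted vertex). The generalized cluster pattern $CP_{(\mathbf{x},B,D)}$ is the assignment of a labeled seed $(\mathbf{x}_t,B_t)$ to every vertex $t$ of $\mathbb{T}_n$ such that the seed at $t_0$ is $(\mathbf{x},B)$ and, for every edge labeled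 $k$, the seeds at its two endpoints are obtained from each other by the seed mutation in direction $k$. The subtree $\mathbb{T}'_3$ of $\mathbb{T}_3$. Let $t_1$ be the vertex joined to $t_0$ by the edge labeled $3$, and $t_2$ the vertex joined to $t_1$ by the edge labeled $2$. $\mathbb{T}'_3$ consists of $t_0$, $t_1$, $t_2$ and all vertices $t$ of $\mathbb{T}_3$ such that the path from $t_1$ to $t$ passes through $t_2$ (so $t_0$ and $t_1$ have one child each, and from $t_2$ on every vertex has two children, along the two edge labels different from that of the edge to its parent). The tree $\mathbb{T}$. It is the infinite rooted tree whose vertices are triples of positive integers, defined as follows. (1) The root is $(1,1,1)$; its only child is $(1,1,3)$; the only child of $(1,1,3)$ is $(1,13,3)$. (2) From $(1,13,3)$ downward, every vertex $(a,b,c)$ has exactly two children: (i) if $a$ is the maximal number in $(a,b,c)$, the children are $(a,6ac-a-b-c,c)$ and $(a,b,6ab-a-b-c)$; (ii) if $b$ is the maximal number, the children are $(6bc-a-b-c,b,c)$ and $(a,b,6ab-a-b-c)$; (iii) if $c$ is the maximal number, the children are $(6bc-a-b-c,b,c)$ and $(a,6ac-a-b-c,c)$. *)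

theory Defs
  imports
    "HOL-Analysis.Analysis"
    "HOL-Library.Poly_Mapping"
    "HOL-Computational_Algebra.Fraction_Field"
begin

section \<open>Rational functions in the indeterminates indexed by a finite type\<close>

type_synonym 'n rat_poly = "('n \<Rightarrow>\<^sub>0 nat) \<Rightarrow>\<^sub>0 rat"
type_synonym 'n rat_fun = "'n rat_poly fract"

instance fract :: ("{idom, ring_char_0}") ring_char_0
proof
  have of_nat_Fract: "(of_nat n :: 'a fract) = Fract (of_nat n) 1" for n
    by (induction n) (simp_all add: Zero_fract_def One_fract_def add.commute)
  show "inj (of_nat :: nat \<Rightarrow> 'a fract)"
    by (rule injI) (simp add: of_nat_Fract eq_fract)
qed

instance fract :: ("{idom, ring_char_0}") field_char_0 ..

definition poly_var :: "'n \<Rightarrow> 'n rat_poly" where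
  "poly_var i = Poly_Mapping.single (Poly_Mapping.single i 1) 1"

definition indeterminates :: "'n rat_fun ^ 'n::{finite, linorder}" where
  "indeterminates = (\<chi> i. Fract (poly_var i) 1)"

definition poly_eval :: "'f::field_char_0 ^ 'n::finite \<Rightarrow> 'n rat_poly \<Rightarrow> 'f" where
  "poly_eval v p =
     (\<Sum>m\<in>Poly_Mapping.keys p.
        of_rat (Poly_Mapping.lookup p m) * (\<Prod>i\<in>UNIV. (v $ i) ^ Poly_Mapping.lookup m i))"

text \<open>
  The rational function \<open>r\<close> is defined at the rational point \<open>v\<close>, and the substitution of
  \<open>v\<close> for the indeterminates turns \<open>r\<close> into \<open>c\<close>.
\<close>
definition has_value_at :: "rat ^ 'n::{finite, linorder} \<Rightarrow> 'n rat_fun \<Rightarrow> rat \<Rightarrow> bool" where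
  "has_value_at v r c \<longleftrightarrow>
     (\<exists>p q. r = Fract p q \<and> poly_eval v q \<noteq> 0 \<and> c = poly_eval v p / poly_eval v q)"


section \<open>Labeled seeds and their mutations\<close>

text \<open>
  Algebraic independence over the rationals, and generation of the ambient field.  An
  ambient field that has such a family is a rational function field in the indeterminates
  indexed by \<open>'n\<close>.
\<close>
definition free_generating :: "'f::field_char_0 ^ 'n::finite \<Rightarrow> bool" where
  "free_generating x \<longleftrightarrow>
     (\<forall>p. poly_eval x p = 0 \<longrightarrow> p = 0) \<and>
     (\<forall>f. \<exists>p q. poly_eval x q \<noteq> 0 \<and> f = poly_eval x p / poly_eval x q)"

definition skew_symmetrizable :: "int ^ 'n ^ 'n \<Rightarrow> bool" where
  "skew_symmetrizable B \<longleftrightarrow>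
     (\<exists>s :: int ^ 'n. (\<forall>i. 0 < s $ i) \<and> (\<forall>i j. s $ i * B $ i $ j = - (s $ j * B $ j $ i)))"

type_synonym ('f, 'n) seed = "('f ^ 'n) \<times> (int ^ 'n ^ 'n)"

definition labeled_seed :: "('f::field_char_0, 'n::finite) seed \<Rightarrow> bool" where
  "labeled_seed S \<longleftrightarrow> free_generating (fst S) \<and> skew_symmetrizable (snd S)"

definition pos_part :: "int \<Rightarrow> int" where
  "pos_part b = max b 0"

text \<open>The vector \<open>d\<close> is the diagonal of the matrix usually denoted by \<open>D\<close>.\<close>
definition seed_mutation ::
    "nat ^ 'n \<Rightarrow> 'n \<Rightarrow> ('f::field_char_0, 'n::finite) seed \<Rightarrow> ('f, 'n) seed" where
  "seed_mutation d k = (\<lambda>(x, B).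
     ((\<chi> j. if j = k
             then (\<Prod>i\<in>UNIV. x $ i powi pos_part (- (B $ i $ k))) ^ (d $ k)
                  * (\<Sum>s = 0..d $ k. (\<Prod>i\<in>UNIV. x $ i powi (B $ i $ k)) ^ s) / x $ k
             else x $ j),
      (\<chi> i j. if i = k \<or> j = k
               then - (B $ i $ j)
               else B $ i $ j
                    + int (d $ k) * (pos_part (B $ i $ k) * B $ k $ j
                                     + B $ i $ k * pos_part (- (B $ k $ j))))))"


section \<open>The regular tree and generalized cluster patterns\<close>

text \<open>
  The regular tree with edges labeled by \<open>'n\<close>, with a base vertex: a vertex is encoded by the
  word of the edge labels along the path from the base vertex \<open>[]\<close> to it.  These are exactly
  the words without equal neighbouring letters.
\<close>
definition tree_vertices :: "'n list set" where
  "tree_vertices = {t. distinct_adj t}"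

definition tree_edge :: "'n \<Rightarrow> 'n list \<Rightarrow> 'n list \<Rightarrow> bool" where
  "tree_edge k t t' \<longleftrightarrow>
     t \<in> tree_vertices \<and> t' \<in> tree_vertices \<and> (t' = t @ [k] \<or> t = t' @ [k])"

definition tree_path :: "'n list list \<Rightarrow> 'n list \<Rightarrow> 'n list \<Rightarrow> bool" where
  "tree_path p t t' \<longleftrightarrow>
     p \<noteq> [] \<and> hd p = t \<and> last p = t' \<and> distinct p \<and> set p \<subseteq> tree_vertices \<and>
     successively (\<lambda>u u'. \<exists>k. tree_edge k u u') p"

definition is_cluster_pattern ::
    "nat ^ 'n \<Rightarrow> ('f::field_char_0, 'n::finite) seed \<Rightarrow> ('n list \<Rightarrow> ('f, 'n) seed) \<Rightarrow> bool" where
  "is_cluster_pattern d S \<Sigma> \<longleftrightarrow>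
     (\<forall>k. 0 < d $ k) \<and>
     (\<forall>t\<in>tree_vertices. labeled_seed (\<Sigma> t)) \<and>
     \<Sigma> [] = S \<and>
     (\<forall>k t t'. tree_edge k t t' \<longrightarrow>
        \<Sigma> t' = seed_mutation d k (\<Sigma> t) \<and> \<Sigma> t = seed_mutation d k (\<Sigma> t'))"

text \<open>Extensionality fixes the irrelevant values on words that are not vertices.\<close>
definition cluster_pattern ::
    "nat ^ 'n \<Rightarrow> ('f::field_char_0, 'n::finite) seed \<Rightarrow> 'n list \<Rightarrow> ('f, 'n) seed" where
  "cluster_pattern d S =
     (THE \<Sigma>. \<Sigma> \<in> extensional tree_vertices \<and> is_cluster_pattern d S \<Sigma>)"

definition cluster_at ::
    "nat ^ 'n \<Rightarrow> ('f::field_char_0, 'n::finite) seed \<Rightarrow> 'n list \<Rightarrow> 'f ^ 'n" where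
  "cluster_at d S t = fst (cluster_pattern d S t)"


section \<open>Rooted trees\<close>

record 'v rooted_tree =
  vertices :: "'v set"
  root_vertex :: 'v
  child :: "'v \<Rightarrow> 'v \<Rightarrow> bool" \<comment> \<open>\<open>child T u v\<close>: \<open>v\<close> is a child of \<open>u\<close>\<close>

definition rooted_tree_iso :: "'v rooted_tree \<Rightarrow> 'w rooted_tree \<Rightarrow> ('v \<Rightarrow> 'w) \<Rightarrow> bool" where
  "rooted_tree_iso T T' \<phi> \<longleftrightarrow>
     bij_betw \<phi> (vertices T) (vertices T') \<and>
     \<phi> (root_vertex T) = root_vertex T' \<and>
     (\<forall>u\<in>vertices T. \<forall>v\<in>vertices T. child T u v \<longleftrightarrow> child T' (\<phi> u) (\<phi> v))"

text \<open>
  The index type \<open>3\<close> has the elements \<open>1\<close>, \<open>2\<close> and \<open>3\<close>.  The words \<open>[3]\<close> and \<open>[3, 2]\<close> encode the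
  vertices \<open>t\<^sub>1\<close> and \<open>t\<^sub>2\<close>.  Extending a word by a letter leads away from the root \<open>[]\<close>.
\<close>
definition subtree_T3 :: "3 list rooted_tree" where
  "subtree_T3 =
     \<lparr> vertices = {[], [3], [3, 2]} \<union>
                  {t \<in> tree_vertices. \<exists>p. tree_path p [3] t \<and> [3, 2] \<in> set p},
       root_vertex = [],
       child = (\<lambda>t t'. \<exists>k. t' = t @ [k]) \<rparr>"

text \<open>
  \<open>below v\<close> means that \<open>v\<close> is \<open>(1, 13, 3)\<close> or a descendant of it; only for these vertices
  do the branching rules apply.
\<close>
inductive triple_child :: "int \<times> int \<times> int \<Rightarrow> int \<times> int \<times> int \<Rightarrow> bool"
  and below :: "int \<times> int \<times> int \<Rightarrow> bool" where
  "triple_child (1, 1, 1) (1, 1, 3)"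
| "triple_child (1, 1, 3) (1, 13, 3)"
| "below (1, 13, 3)"
| "below v \<Longrightarrow> triple_child v w \<Longrightarrow> below w"
| "below (a, b, c) \<Longrightarrow> a = Max {a, b, c} \<Longrightarrow>
     triple_child (a, b, c) (a, 6 * a * c - a - b - c, c)"
| "below (a, b, c) \<Longrightarrow> a = Max {a, b, c} \<Longrightarrow>
     triple_child (a, b, c) (a, b, 6 * a * b - a - b - c)"
| "below (a, b, c) \<Longrightarrow> b = Max {a, b, c} \<Longrightarrow>
     triple_child (a, b, c) (6 * b * c - a - b - c, b, c)"
| "below (a, b, c) \<Longrightarrow> b = Max {a, b, c} \<Longrightarrow>
     triple_child (a, b, c) (a, b, 6 * a * b - a - b - c)"
| "below (a, b, c) \<Longrightarrow> c = Max {a, b, c} \<Longrightarrow>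
     triple_child (a, b, c) (6 * b * c - a - b - c, b, c)"
| "below (a, b, c) \<Longrightarrow> c = Max {a, b, c} \<Longrightarrow>
     triple_child (a, b, c) (a, 6 * a * c - a - b - c, c)"

definition triple_tree :: "(int \<times> int \<times> int) rooted_tree" where
  "triple_tree =
     \<lparr> vertices = {v. triple_child\<^sup>*\<^sup>* (1, 1, 1) v},
       root_vertex = (1, 1, 1),
       child = triple_child \<rparr>"


section \<open>The initial seed and the substitution\<close>

definition \<Delta> :: "int ^ 3 ^ 3" where
  "\<Delta> = vector [vector [0, 1, -1], vector [-1, 0, 1], vector [1, -1, 0]]"

definition cluster_value_at_1 :: "(3 rat_fun) ^ 3 \<Rightarrow> int \<times> int \<times> int \<Rightarrow> bool" where
  "cluster_value_at_1 x = (\<lambda>(a, b, c).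
     has_value_at (\<chi> i. 1) (x $ 1) (of_int a) \<and>
     has_value_at (\<chi> i. 1) (x $ 2) (of_int b) \<and>
     has_value_at (\<chi> i. 1) (x $ 3) (of_int c))"

end

theory Submission
  imports Defs
begin

text \<open>
  Mutation at \<open>k\<close> sends \<open>\<Delta>\<close> to \<open>-\<Delta>\<close> and back, so every mutation has the shape
  \<open>x\<^sub>k x'\<^sub>k = x\<^sub>i\<^sup>2 + x\<^sub>i x\<^sub>j + x\<^sub>j\<^sup>2\<close>.  At \<open>(1,1,1)\<close> this preserves the equation
  \<open>a\<^sup>2 + b\<^sup>2 + c\<^sup>2 + ab + bc + ca = 6abc\<close>, a quadratic in each variable whose two roots are
  exchanged; their sum gives the rule \<open>a' = 6bc - a - b - c\<close>.  In the tree of triples the entry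
  mutated last is the strict maximum, so the triple determines the last letter of the word, hence
  its parent triple, hence by induction the whole word.
\<close>

section \<open>Evaluation of polynomials\<close>

text \<open>Claims additive in the polynomial thereby reduce to single monomials. The added key may
  already occur, so no freshness has to be tracked.\<close>

lemma poly_mapping_add_single_induct [case_names zero single_add]:
  assumes "P 0"
    and "\<And>f a b. P f \<Longrightarrow> P (Poly_Mapping.single a b + f)"
  shows "P (f :: 'a \<Rightarrow>\<^sub>0 'b::comm_monoid_add)"
proof (induction f rule: update_induct)
  case const
  show ?case by (fact assms(1))
next
  case (update f a b)
  have "Poly_Mapping.update a b f = Poly_Mapping.single a b + f"
    using update.hyps
    by (intro poly_mapping_eqI)
       (auto simp: lookup_update lookup_add lookup_single when_def in_keys_iff)
  with assms(2)[OF update.IH] show ?case by simp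
qed

text \<open>Cancellation can shrink the keys of a sum; a common larger index set makes additivity
  termwise.\<close>

lemma poly_eval_superset:
  assumes "finite A" "Poly_Mapping.keys p \<subseteq> A"
  shows "poly_eval v p =
    (\<Sum>m\<in>A. of_rat (Poly_Mapping.lookup p m) * (\<Prod>i\<in>UNIV. (v $ i) ^ Poly_Mapping.lookup m i))"
  unfolding poly_eval_def using assms
  by (intro sum.mono_neutral_left) (auto simp: in_keys_iff)

lemma poly_eval_0 [simp]: "poly_eval v 0 = 0"
  by (simp add: poly_eval_def)

lemma poly_eval_single:
  "poly_eval v (Poly_Mapping.single m c) =
     of_rat c * (\<Prod>i\<in>UNIV. (v $ i) ^ Poly_Mapping.lookup m i)"
  by (subst poly_eval_superset[of "{m}"]) auto

lemma poly_eval_1 [simp]: "poly_eval v 1 = 1"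
  using poly_eval_single[of v 0 1] by simp

lemma poly_eval_add [simp]: "poly_eval v (p + q) = poly_eval v p + poly_eval v q"
proof -
  let ?A = "Poly_Mapping.keys p \<union> Poly_Mapping.keys q"
  have "Poly_Mapping.keys (p + q) \<subseteq> ?A"
    by (rule keys_add)
  then show ?thesis
    by (simp add: poly_eval_superset[of ?A] lookup_add of_rat_add distrib_right sum.distrib)
qed

lemma poly_eval_sum [simp]: "poly_eval v (\<Sum>i\<in>A. p i) = (\<Sum>i\<in>A. poly_eval v (p i))"
  by (induction A rule: infinite_finite_induct) simp_all

lemma poly_eval_mult [simp]:
  fixes p q :: "'n::finite rat_poly"
  shows "poly_eval v (p * q) = poly_eval v p * poly_eval v q"
proof (induction p rule: poly_mapping_add_single_induct)
  case (single_add p m a)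
  have "poly_eval v (Poly_Mapping.single m a * q) = poly_eval v (Poly_Mapping.single m a) * poly_eval v q"
  proof (induction q rule: poly_mapping_add_single_induct)
    case (single_add q n b)
    then show ?case
      by (simp add: distrib_left mult_single poly_eval_single lookup_add power_add prod.distrib
          of_rat_mult mult_ac)
  qed simp
  with single_add show ?case
    by (simp add: distrib_right)
qed simp

lemma poly_eval_power [simp]:
  fixes p :: "'n::finite rat_poly"
  shows "poly_eval v (p ^ e) = poly_eval v p ^ e"
  by (induction e) simp_all

lemma poly_eval_prod [simp]:
  fixes p :: "'a \<Rightarrow> 'n::finite rat_poly"
  shows "poly_eval v (\<Prod>i\<in>A. p i) = (\<Prod>i\<in>A. poly_eval v (p i))"
  by (induction A rule: infinite_finite_induct) simp_all

lemma poly_eval_var [simp]: "poly_eval v (poly_var i) = v $ i"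
proof -
  have "(\<Prod>j\<in>UNIV. (v $ j) ^ Poly_Mapping.lookup (Poly_Mapping.single i (1::nat)) j) =
      (\<Prod>j\<in>UNIV. if j = i then v $ j else 1)"
    by (intro prod.cong) (auto simp: lookup_single when_def)
  then show ?thesis
    by (simp add: poly_var_def poly_eval_single)
qed

section \<open>Free generating sets\<close>

lemma free_generating_nonzero:
  assumes "free_generating x"
  shows "x $ i \<noteq> 0"
proof
  assume "x $ i = 0"
  then have "poly_eval x (poly_var i) = 0" by simp
  with assms have "poly_var i = 0"
    unfolding free_generating_def by blast
  then show False
    by (simp add: poly_var_def flip: single_zero) (metis lookup_single_eq lookup_zero zero_neq_one)
qed

text \<open>Substituting \<open>poly_eval z P / z $ k\<close> for the variable \<open>k\<close> puts
  only powers of \<open>z $ k\<close> into the denominator. Since \<open>q\<close> and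
  \<open>N\<close> are chosen before \<open>z\<close>, one identity serves both a family and its
  exchange.\<close>

lemma poly_eval_clear_denominators:
  fixes P p :: "'n::finite rat_poly"
  shows "\<exists>q N. \<forall>z :: 'f::field_char_0 ^ 'n. z $ k \<noteq> 0 \<longrightarrow>
    poly_eval z q = poly_eval (\<chi> i. if i = k then poly_eval z P / z $ k else z $ i) p * (z $ k) ^ N"
proof (induction p rule: poly_mapping_add_single_induct)
  case zero
  show ?case by (intro exI[of _ 0]) simp
next
  case (single_add p m a)
  then obtain q N where q: "\<And>z :: 'f ^ 'n. z $ k \<noteq> 0 \<Longrightarrow>
      poly_eval z q = poly_eval (\<chi> i. if i = k then poly_eval z P / z $ k else z $ i) p * (z $ k) ^ N"
    by blast
  let ?M = "Poly_Mapping.lookup m k"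
  \<comment> \<open>The monomial after the substitution, times the \<open>?M\<close>-th power of
    \<open>z $ k\<close>. To reach the common power \<open>?M + N\<close>, each summand is
    multiplied by the power that it lacks.\<close>
  let ?s = "Poly_Mapping.single 0 a * P ^ ?M *
      (\<Prod>i\<in>-{k}. poly_var i ^ Poly_Mapping.lookup m i)"
  have "poly_eval z (?s * poly_var k ^ N + q * poly_var k ^ ?M) =
      poly_eval (\<chi> i. if i = k then poly_eval z P / z $ k else z $ i) (Poly_Mapping.single m a + p)
      * (z $ k) ^ (?M + N)" if z: "z $ k \<noteq> 0" for z :: "'f ^ 'n"
  proof -
    let ?z = "\<chi> i. if i = k then poly_eval z P / z $ k else z $ i"
    have "(\<Prod>i\<in>UNIV. (?z $ i) ^ Poly_Mapping.lookup m i) =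
        (poly_eval z P / z $ k) ^ ?M * (\<Prod>i\<in>-{k}. (z $ i) ^ Poly_Mapping.lookup m i)"
      by (subst prod.remove[of _ k]) (auto simp: Compl_eq_Diff_UNIV intro!: prod.cong)
    then have "poly_eval z ?s = poly_eval ?z (Poly_Mapping.single m a) * (z $ k) ^ ?M"
      using z by (simp add: poly_eval_single power_divide)
    then show ?thesis
      using q[OF z] by (simp add: algebra_simps power_add)
  qed
  then show ?case by blast
qed

text \<open>
  The exchange is an involution that is birational in the variables, so a polynomial relation
  satisfied by the new family pulls back to a polynomial relation satisfied by the old one.
  The latter is trivial, and evaluating it at the new family gives back the original relation
  for the old family.
\<close>
lemma free_generating_exchange:
  fixes x :: "'f::field_char_0 ^ 'n::finite"
  assumes x: "free_generating x"
    and P: "\<And>(z :: 'f ^ 'n) c. poly_eval (\<chi> i. if i = k then c else z $ i) P = poly_eval z P"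
    and P0: "P \<noteq> 0"
  shows "free_generating (\<chi> i. if i = k then poly_eval x P / x $ k else x $ i)"
proof -
  define \<mu> where "\<mu> z = (\<chi> i. if i = k then poly_eval z P / z $ k else z $ i)" for z :: "'f ^ 'n"
  note clear = poly_eval_clear_denominators[where k = k and P = P and 'f = 'f, folded \<mu>_def]
  have Px: "poly_eval x P \<noteq> 0"
    using x P0 unfolding free_generating_def by blast
  have xk: "x $ k \<noteq> 0"
    using x by (rule free_generating_nonzero)
  have yk: "\<mu> x $ k \<noteq> 0"
    using Px xk by (simp add: \<mu>_def)
  \<comment> \<open>\<open>P\<close> does not involve the variable \<open>k\<close>, so the exchange
    keeps its value and the second division undoes the first.\<close>
  have invol: "\<mu> (\<mu> x) = x"
  proof -
    have "poly_eval (\<mu> x) P = poly_eval x P"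
      unfolding \<mu>_def by (rule P)
    then show ?thesis
      using Px xk by (subst \<mu>_def) (simp add: vec_eq_iff, simp add: \<mu>_def)
  qed
  have "p = 0" if p: "poly_eval (\<mu> x) p = 0" for p
  proof -
    obtain q N where q: "\<And>z :: 'f ^ 'n. z $ k \<noteq> 0 \<Longrightarrow>
        poly_eval z q = poly_eval (\<mu> z) p * (z $ k) ^ N"
      using clear by blast
    have "poly_eval x q = 0"
      using q[OF xk] p by simp
    then have "q = 0"
      using x unfolding free_generating_def by blast
    then have "poly_eval x p = 0"
      using q[OF yk] yk by (simp add: invol)
    then show "p = 0"
      using x unfolding free_generating_def by blast
  qed
  moreover have "\<exists>p q. poly_eval (\<mu> x) q \<noteq> 0 \<and> f = poly_eval (\<mu> x) p / poly_eval (\<mu> x) q" for f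
  proof -
    obtain p q where pq: "poly_eval x q \<noteq> 0" "f = poly_eval x p / poly_eval x q"
      using x unfolding free_generating_def by blast
    obtain p' M where p': "\<And>z :: 'f ^ 'n. z $ k \<noteq> 0 \<Longrightarrow>
        poly_eval z p' = poly_eval (\<mu> z) p * (z $ k) ^ M"
      using clear by blast
    obtain q' N where q': "\<And>z :: 'f ^ 'n. z $ k \<noteq> 0 \<Longrightarrow>
        poly_eval z q' = poly_eval (\<mu> z) q * (z $ k) ^ N"
      using clear by blast
    \<comment> \<open>At \<open>\<mu> x\<close>, which \<open>\<mu>\<close> maps back to
      \<open>x\<close>, the cleared polynomials give the numerator and denominator of
      \<open>f\<close> up to the powers \<open>M\<close> and \<open>N\<close> of the new variable;
      the crosswise factors balance them.\<close>
    have "poly_eval (\<mu> x) (q' * poly_var k ^ M) \<noteq> 0 \<and>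
        f = poly_eval (\<mu> x) (p' * poly_var k ^ N) / poly_eval (\<mu> x) (q' * poly_var k ^ M)"
      using pq p'[OF yk] q'[OF yk] yk by (simp add: invol)
    then show ?thesis by blast
  qed
  ultimately have "free_generating (\<mu> x)"
    unfolding free_generating_def by blast
  then show ?thesis
    by (simp add: \<mu>_def)
qed

section \<open>The indeterminates form a free generating set\<close>

lemma of_rat_fract:
  "(of_rat c :: 'n::{finite, linorder} rat_fun) = Fract (Poly_Mapping.single 0 c) 1"
proof (cases c)
  case (Fract a b)
  have of_int_fract: "(of_int n :: 'n rat_fun) = Fract (of_int n) 1" for n
    by (cases n) (simp_all add: of_nat_fract One_fract_def)
  have c: "c = of_int a / of_int b"
    using Fract by (simp add: Fract_of_int_quotient)
  have "(Poly_Mapping.single 0 (of_int b) :: 'n rat_poly) \<noteq> 0"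
    using Fract by simp
  moreover have "(of_rat c :: 'n rat_fun) =
      Fract (Poly_Mapping.single 0 (of_int a)) (Poly_Mapping.single 0 (of_int b))"
    by (simp add: c of_rat_divide of_int_fract)
  moreover have "(Poly_Mapping.single 0 (of_int a) :: 'n rat_poly) =
      Poly_Mapping.single 0 c * Poly_Mapping.single 0 (of_int b)"
    using \<open>0 < b\<close> by (simp add: mult_single c flip: single_of_int)
  ultimately show ?thesis
    by (simp add: eq_fract)
qed

text \<open>Both sides are additive, so monomials suffice. Both conditions of
  \<open>free_generating\<close> then become plain facts about fractions.\<close>

lemma poly_eval_indeterminates:
  "poly_eval indeterminates p = Fract (p :: 'n::{finite, linorder} rat_poly) 1"
proof (induction p rule: poly_mapping_add_single_induct)
  case zero
  show ?case by (simp add: Zero_fract_def)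
next
  case (single_add p m a)
  have power: "Fract q 1 ^ e = Fract (q ^ e) 1" for q :: "'n rat_poly" and e
    by (induction e) (simp_all add: One_fract_def)
  have prod: "(\<Prod>i\<in>A. Fract (g i) 1) = Fract (prod g A) 1" for g :: "'n \<Rightarrow> 'n rat_poly" and A
    by (induction A rule: infinite_finite_induct) (simp_all add: One_fract_def)
  have var_power: "poly_var i ^ e = Poly_Mapping.single (Poly_Mapping.single i e) 1"
    for i :: 'n and e
    by (induction e) (simp_all add: poly_var_def mult_single flip: Poly_Mapping.single_add)
  have prod_single: "(\<Prod>i\<in>A. Poly_Mapping.single (h i) (1::rat)) = Poly_Mapping.single (sum h A) 1"
    for h :: "'n \<Rightarrow> 'n \<Rightarrow>\<^sub>0 nat" and A
    by (induction A rule: infinite_finite_induct) (simp_all add: mult_single)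
  have "(\<Sum>i\<in>UNIV. Poly_Mapping.single i (Poly_Mapping.lookup m i)) = m"
    by (rule poly_mapping_eqI) (simp add: lookup_sum lookup_single when_def)
  then have "poly_eval indeterminates (Poly_Mapping.single m a) = Fract (Poly_Mapping.single m a) 1"
    by (simp add: poly_eval_single indeterminates_def power prod var_power prod_single of_rat_fract
        mult_single)
  with single_add show ?case
    by simp
qed

lemma free_generating_indeterminates:
  "free_generating (indeterminates :: 'n rat_fun ^ 'n::{finite, linorder})"
  unfolding free_generating_def poly_eval_indeterminates
proof (intro conjI allI impI)
  fix p :: "'n rat_poly"
  assume "Fract p 1 = 0"
  then show "p = 0"
    by (simp add: Zero_fract_def eq_fract)
next
  fix f :: "'n rat_fun"
  obtain p q where "f = Fract p q" "q \<noteq> 0"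
    by (rule Fract_cases)
  then show "\<exists>p q. Fract q 1 \<noteq> 0 \<and> f = Fract p 1 / Fract q 1"
    by (intro exI[of _ p] exI[of _ q]) (simp add: Zero_fract_def eq_fract)
qed

section \<open>Values of rational functions\<close>

lemma has_value_at_indeterminates: "has_value_at v (indeterminates $ i) (v $ i)"
  unfolding has_value_at_def indeterminates_def
  by (intro exI[of _ "poly_var i"] exI[of _ 1]) simp

lemma has_value_at_add:
  assumes "has_value_at v r c" "has_value_at v s e"
  shows "has_value_at v (r + s) (c + e)"
proof -
  obtain p q where pq: "r = Fract p q" "poly_eval v q \<noteq> 0" "c = poly_eval v p / poly_eval v q"
    using assms(1) unfolding has_value_at_def by blast
  obtain p' q' where pq': "s = Fract p' q'" "poly_eval v q' \<noteq> 0" "e = poly_eval v p' / poly_eval v q'"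
    using assms(2) unfolding has_value_at_def by blast
  \<comment> \<open>The sum rule for \<open>Fract\<close> requires nonzero denominators; a nonzero
    value at \<open>v\<close> guarantees this.\<close>
  from pq(2) pq'(2) have "q \<noteq> 0" "q' \<noteq> 0"
    by auto
  with pq pq' show ?thesis
    unfolding has_value_at_def
    by (intro exI[of _ "p * q' + p' * q"] exI[of _ "q * q'"]) (simp add: add_frac_eq)
qed

lemma has_value_at_mult:
  assumes "has_value_at v r c" "has_value_at v s e"
  shows "has_value_at v (r * s) (c * e)"
proof -
  obtain p q where pq: "r = Fract p q" "poly_eval v q \<noteq> 0" "c = poly_eval v p / poly_eval v q"
    using assms(1) unfolding has_value_at_def by blast
  obtain p' q' where pq': "s = Fract p' q'" "poly_eval v q' \<noteq> 0" "e = poly_eval v p' / poly_eval v q'"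
    using assms(2) unfolding has_value_at_def by blast
  from pq pq' show ?thesis
    unfolding has_value_at_def
    by (intro exI[of _ "p * p'"] exI[of _ "q * q'"]) simp
qed

lemma has_value_at_divide:
  assumes "has_value_at v r c" "has_value_at v s e" "e \<noteq> 0"
  shows "has_value_at v (r / s) (c / e)"
proof -
  obtain p q where pq: "r = Fract p q" "poly_eval v q \<noteq> 0" "c = poly_eval v p / poly_eval v q"
    using assms(1) unfolding has_value_at_def by blast
  obtain p' q' where pq': "s = Fract p' q'" "poly_eval v q' \<noteq> 0" "e = poly_eval v p' / poly_eval v q'"
    using assms(2) unfolding has_value_at_def by blast
  from pq pq' assms(3) show ?thesis
    unfolding has_value_at_def
    by (intro exI[of _ "p * q'"] exI[of _ "q * p'"]) simp
qed

section \<open>Mutation of the seed\<close>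

text \<open>With three variables this is the numerator of a mutation with \<open>d $ k = 2\<close>
  whose matrix column has the entries 1 and -1 off the diagonal.\<close>

definition exchange_poly :: "'n::finite \<Rightarrow> 'n rat_poly" where
  "exchange_poly k = (\<Sum>i\<in>-{k}. poly_var i ^ 2) + (\<Prod>i\<in>-{k}. poly_var i)"

definition cluster_exchange :: "'n \<Rightarrow> 'f::field_char_0 ^ 'n::finite \<Rightarrow> 'f ^ 'n" where
  "cluster_exchange k x = (\<chi> i. if i = k then poly_eval x (exchange_poly k) / x $ k else x $ i)"

lemma poly_eval_exchange_poly_upd:
  "poly_eval (\<chi> i. if i = k then c else z $ i) (exchange_poly k) = poly_eval z (exchange_poly k)"
  by (auto simp: exchange_poly_def intro!: arg_cong2[where f = "(+)"] sum.cong prod.cong)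

lemma exchange_poly_nonzero: "exchange_poly (k :: 'n::finite) \<noteq> 0"
proof
  assume "exchange_poly k = 0"
  \<comment> \<open>At the all-ones point every square and the product equal 1, so the value is
    positive.\<close>
  then have "poly_eval ((\<chi> i. 1) :: rat ^ 'n) (exchange_poly k) = 0" by simp
  then have "of_nat (card (-{k})) + 1 = (0 :: rat)"
    by (simp add: exchange_poly_def del: of_nat_eq_0_iff)
  then show False
    by (simp add: add.commute flip: of_nat_Suc)
qed

lemma free_generating_cluster_exchange:
  "free_generating x \<Longrightarrow> free_generating (cluster_exchange k x)"
  unfolding cluster_exchange_def
  by (rule free_generating_exchange[OF _ poly_eval_exchange_poly_upd exchange_poly_nonzero])

lemma cluster_exchange_involution:
  assumes "free_generating x"
  shows "cluster_exchange k (cluster_exchange k x) = x"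
proof -
  have "poly_eval x (exchange_poly k) \<noteq> 0"
    using assms exchange_poly_nonzero unfolding free_generating_def by blast
  moreover have "poly_eval (cluster_exchange k x) (exchange_poly k) = poly_eval x (exchange_poly k)"
    unfolding cluster_exchange_def by (rule poly_eval_exchange_poly_upd)
  ultimately show ?thesis
    using free_generating_nonzero[OF assms]
    by (subst cluster_exchange_def) (simp add: vec_eq_iff, simp add: cluster_exchange_def)
qed

section \<open>Mutation of the cyclic matrix in three variables\<close>

lemma Compl_singleton_3: "- {1 :: 3} = {2, 3}" "- {2 :: 3} = {1, 3}" "- {3 :: 3} = {1, 2}"
  using exhaust_3 by auto

lemma prod_UNIV_3: "prod f (UNIV :: 3 set) = f 1 * f 2 * f 3"
  unfolding UNIV_3 by (simp add: ac_simps)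

lemma \<Delta>_entries [simp]:
  "\<Delta> $ 1 $ 1 = 0" "\<Delta> $ 1 $ 2 = 1" "\<Delta> $ 1 $ 3 = -1"
  "\<Delta> $ 2 $ 1 = -1" "\<Delta> $ 2 $ 2 = 0" "\<Delta> $ 2 $ 3 = 1"
  "\<Delta> $ 3 $ 1 = 1" "\<Delta> $ 3 $ 2 = -1" "\<Delta> $ 3 $ 3 = 0"
  by (simp_all add: \<Delta>_def)

text \<open>For \<open>y = x_i / x_j\<close> the numerator is \<open>x_j^2 (1 + y + y^2)\<close>,
  which is symmetric in i and j, so the sign of the matrix does not affect the cluster. Away from
  row and column \<open>k\<close>, the correction to an off-diagonal entry b is -2b, which flips its
  sign.\<close>

lemma seed_mutation_\<Delta>:
  assumes "free_generating (fst S)" "snd S = \<Delta> \<or> snd S = - \<Delta>"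
  shows "seed_mutation (\<chi> i. 2) k S = (cluster_exchange k (fst S), - snd S)"
proof (cases S)
  case (Pair x B)
  then have "x $ i \<noteq> 0" for i
    using assms(1) by (simp add: free_generating_nonzero)
  moreover note Pair assms(2)
  moreover
  have "{0..2::nat} = {0, 1, 2}" by auto
  ultimately show ?thesis
    using exhaust_3[of k]
    by (auto simp: seed_mutation_def cluster_exchange_def exchange_poly_def vec_eq_iff forall_3
        prod_UNIV_3 pos_part_def Compl_singleton_3 field_simps power2_eq_square power_int_minus)
qed

lemma skew_symmetrizable_\<Delta>: "skew_symmetrizable \<Delta>" "skew_symmetrizable (- \<Delta>)"
  unfolding skew_symmetrizable_def
  by (rule exI[of _ "\<chi> i. 1"]; simp add: forall_3)+

text \<open>Defined on all words, also those with repeated neighbours, so that induction over words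
  needs no side condition.\<close>

definition seed_at :: "3 list \<Rightarrow> (3 rat_fun, 3) seed" where
  "seed_at = foldl (\<lambda>S k. seed_mutation (\<chi> i. 2) k S) (indeterminates, \<Delta>)"

lemma seed_at_Nil [simp]: "seed_at [] = (indeterminates, \<Delta>)"
  by (simp add: seed_at_def)

lemma seed_at_snoc: "seed_at (t @ [k]) = seed_mutation (\<chi> i. 2) k (seed_at t)"
  by (simp add: seed_at_def)

lemma seed_at_invariant:
  "free_generating (fst (seed_at t)) \<and> (snd (seed_at t) = \<Delta> \<or> snd (seed_at t) = - \<Delta>)"
proof (induction t rule: rev_induct)
  case Nil
  show ?case by (simp add: free_generating_indeterminates)
next
  case (snoc k t)
  then have "seed_at (t @ [k]) = (cluster_exchange k (fst (seed_at t)), - snd (seed_at t))"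
    unfolding seed_at_snoc by (intro seed_mutation_\<Delta>) auto
  with snoc show ?case
    by (auto intro: free_generating_cluster_exchange)
qed

lemma labeled_seed_at: "labeled_seed (seed_at t)"
  using seed_at_invariant[of t] skew_symmetrizable_\<Delta> by (auto simp: labeled_seed_def)

lemma seed_at_snoc_exchange:
  "seed_at (t @ [k]) = (cluster_exchange k (fst (seed_at t)), - snd (seed_at t))"
  unfolding seed_at_snoc using seed_at_invariant[of t] by (intro seed_mutation_\<Delta>) auto

text \<open>A cluster pattern demands mutation along each edge in both directions; this is the
  direction towards the root.\<close>

lemma seed_mutation_seed_at_snoc: "seed_mutation (\<chi> i. 2) k (seed_at (t @ [k])) = seed_at t"
proof -
  have "seed_mutation (\<chi> i. 2) k (seed_at (t @ [k])) =
      (cluster_exchange k (fst (seed_at (t @ [k]))), - snd (seed_at (t @ [k])))"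
    using seed_at_invariant[of "t @ [k]"] by (intro seed_mutation_\<Delta>) auto
  also have "\<dots> = seed_at t"
    using seed_at_invariant[of t] by (simp add: seed_at_snoc_exchange cluster_exchange_involution)
  finally show ?thesis .
qed

lemma tree_vertices_snocD: "t @ [k] \<in> tree_vertices \<Longrightarrow> t \<in> tree_vertices"
  by (auto simp: tree_vertices_def)

text \<open>Uniqueness follows by walking from the base vertex: each vertex word is reached from its
  prefix by one edge, which forces the seed.\<close>

lemma cluster_pattern_eq:
  "cluster_pattern (\<chi> i. 2) (indeterminates, \<Delta>) = restrict seed_at tree_vertices"
  unfolding cluster_pattern_def
proof (rule the_equality)
  have "is_cluster_pattern (\<chi> i. 2) (indeterminates, \<Delta>) (restrict seed_at tree_vertices)"
    unfolding is_cluster_pattern_def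
    using labeled_seed_at seed_mutation_seed_at_snoc
    by (auto simp: tree_edge_def seed_at_snoc[symmetric, of t for t] tree_vertices_def)
  then show "restrict seed_at tree_vertices \<in> extensional tree_vertices \<and>
      is_cluster_pattern (\<chi> i. 2) (indeterminates, \<Delta>) (restrict seed_at tree_vertices)"
    by simp
next
  fix \<Sigma> :: "3 list \<Rightarrow> (3 rat_fun, 3) seed"
  assume \<Sigma>: "\<Sigma> \<in> extensional tree_vertices \<and> is_cluster_pattern (\<chi> i. 2) (indeterminates, \<Delta>) \<Sigma>"
  have "t \<in> tree_vertices \<Longrightarrow> \<Sigma> t = seed_at t" for t
  proof (induction t rule: rev_induct)
    case Nil
    show ?case using \<Sigma> by (simp add: is_cluster_pattern_def)
  next
    case (snoc k t)
    have "t \<in> tree_vertices"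
      using snoc.prems by (rule tree_vertices_snocD)
    with snoc.prems have "tree_edge k t (t @ [k])"
      by (simp add: tree_edge_def)
    then have "\<Sigma> (t @ [k]) = seed_mutation (\<chi> i. 2) k (\<Sigma> t)"
      using \<Sigma> unfolding is_cluster_pattern_def by blast
    with snoc.IH \<open>t \<in> tree_vertices\<close> show ?case
      by (simp add: seed_at_snoc)
  qed
  with \<Sigma> show "\<Sigma> = restrict seed_at tree_vertices"
    by (intro extensionalityI[of _ tree_vertices]) auto
qed

section \<open>The triples\<close>

text \<open>For fixed other entries p and q, the roots of the quadratic in entry \<open>k\<close>
  add up to 6pq - p - q. The sum over \<open>UNIV\<close> also subtracts the old root.\<close>

definition markov_step :: "3 \<Rightarrow> int ^ 3 \<Rightarrow> int ^ 3" where
  "markov_step k v =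
     (\<chi> i. if i = k then 6 * (\<Prod>j\<in>-{k}. v $ j) - (\<Sum>j\<in>UNIV. v $ j) else v $ i)"

definition values_at :: "3 list \<Rightarrow> int ^ 3" where
  "values_at = foldl (\<lambda>v k. markov_step k v) (\<chi> i. 1)"

lemma values_at_Nil [simp]: "values_at [] = (\<chi> i. 1)"
  by (simp add: values_at_def)

lemma values_at_snoc: "values_at (t @ [k]) = markov_step k (values_at t)"
  by (simp add: values_at_def)

lemma markov_step_involution: "markov_step k (markov_step k v) = v"
  using exhaust_3[of k]
  by (auto simp: markov_step_def vec_eq_iff forall_3 Compl_singleton_3 sum_3)

definition markov_triple :: "int ^ 3 \<Rightarrow> bool" where
  "markov_triple v \<longleftrightarrow> (\<forall>i. 0 < v $ i) \<and>
     (v $ 1)\<^sup>2 + (v $ 2)\<^sup>2 + (v $ 3)\<^sup>2 + v $ 1 * v $ 2 + v $ 2 * v $ 3 + v $ 3 * v $ 1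
       = 6 * v $ 1 * v $ 2 * v $ 3"

text \<open>
  The Markov-type equation is quadratic in each variable; by Vieta, exchanging one root
  for the other is the same as dividing the product of the roots by the old root.
\<close>
lemma markov_step_mult:
  assumes "markov_triple v"
  shows "v $ k * markov_step k v $ k = (\<Sum>i\<in>-{k}. (v $ i)\<^sup>2) + (\<Prod>i\<in>-{k}. v $ i)"
  using assms exhaust_3[of k]
  by (auto simp: markov_triple_def markov_step_def Compl_singleton_3 sum_3 algebra_simps power2_eq_square)

text \<open>The product of old and new entry is a sum of squares plus a positive product, so the new
  entry is positive; as the other root it satisfies the same equation.\<close>

lemma markov_triple_step:
  assumes "markov_triple v"
  shows "markov_triple (markov_step k v)"
proof -
  have pos: "0 < v $ i" for i
    using assms by (simp add: markov_triple_def)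
  have "0 < v $ k * markov_step k v $ k"
    unfolding markov_step_mult[OF assms]
    by (intro add_nonneg_pos sum_nonneg prod_pos) (use pos in auto)
  then have "0 < markov_step k v $ k"
    using pos[of k] by (simp add: zero_less_mult_iff)
  then have "0 < markov_step k v $ i" for i
    using pos[of i] by (cases "i = k") (simp_all add: markov_step_def)
  moreover have "(markov_step k v $ 1)\<^sup>2 + (markov_step k v $ 2)\<^sup>2 + (markov_step k v $ 3)\<^sup>2
      + markov_step k v $ 1 * markov_step k v $ 2 + markov_step k v $ 2 * markov_step k v $ 3
      + markov_step k v $ 3 * markov_step k v $ 1
      = 6 * markov_step k v $ 1 * markov_step k v $ 2 * markov_step k v $ 3"
    using assms exhaust_3[of k]
    by (auto simp: markov_triple_def markov_step_def Compl_singleton_3 sum_3 algebra_simps power2_eq_square)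
  ultimately show ?thesis
    by (simp add: markov_triple_def)
qed

lemma markov_triple_values_at: "markov_triple (values_at t)"
  by (induction t rule: rev_induct)
     (simp add: markov_triple_def, simp add: values_at_snoc markov_triple_step)

text \<open>The exchange divides by a variable whose value is a positive integer, so the quotient is
  defined at the all-ones point; \<open>markov_step_mult\<close> identifies its value with the
  integer rule.\<close>

lemma seed_at_values:
  "has_value_at (\<chi> i. 1) (fst (seed_at t) $ i) (of_int (values_at t $ i))"
proof (induction t arbitrary: i rule: rev_induct)
  case Nil
  show ?case using has_value_at_indeterminates[of "\<chi> i. 1" i] by simp
next
  case (snoc k t)
  let ?x = "fst (seed_at t)" and ?v = "values_at t"
  show ?case
  proof (cases "i = k")
    case False
    with snoc[of i] show ?thesis
      by (simp add: seed_at_snoc_exchange values_at_snoc cluster_exchange_def markov_step_def)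
  next
    case True
    have "0 < ?v $ k"
      using markov_triple_values_at[of t] by (simp add: markov_triple_def)
    moreover from this have "of_int (markov_step k ?v $ k) =
        (of_int ((\<Sum>i\<in>-{k}. (?v $ i)\<^sup>2) + (\<Prod>i\<in>-{k}. ?v $ i)) :: rat) / of_int (?v $ k)"
      unfolding markov_step_mult[OF markov_triple_values_at, symmetric] by simp
    moreover have "has_value_at (\<chi> i. 1) (poly_eval ?x (exchange_poly k))
        (of_int ((\<Sum>i\<in>-{k}. (?v $ i)\<^sup>2) + (\<Prod>i\<in>-{k}. ?v $ i)))"
      using exhaust_3[of k] snoc
      by (auto simp: exchange_poly_def Compl_singleton_3 power2_eq_square
          intro!: has_value_at_add has_value_at_mult)
    ultimately show ?thesis
      using True has_value_at_divide[OF _ snoc[of k]]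
      by (simp add: seed_at_snoc_exchange values_at_snoc cluster_exchange_def)
  qed
qed

section \<open>The isomorphism of rooted trees\<close>

definition strict_max_at :: "3 \<Rightarrow> int ^ 3 \<Rightarrow> bool" where
  "strict_max_at k v \<longleftrightarrow> (\<forall>i. i \<noteq> k \<longrightarrow> v $ i < v $ k)"

lemma strict_max_at_markov_step:
  assumes "markov_triple v" "strict_max_at l v" "k \<noteq> l"
  shows "strict_max_at k (markov_step k v)"
proof -
  \<comment> \<open>Here \<open>a\<close> is the old maximum, \<open>b\<close> the other entry kept
    and \<open>c\<close> the entry replaced. As \<open>b\<close> is at least 1, the new entry is at
    least 5a - b - c, which exceeds 3a.\<close>
  have *: "a < 6 * a * b - a - b - c" "b < 6 * a * b - a - b - c"
    if "0 < a" "0 < b" "0 < c" "b < a" "c < a" for a b c :: int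
  proof -
    have "a * 1 \<le> a * b"
      using that by (intro mult_left_mono) auto
    then show "a < 6 * a * b - a - b - c" using that by linarith
    with that show "b < 6 * a * b - a - b - c" by linarith
  qed
  have pos: "0 < v $ 1" "0 < v $ 2" "0 < v $ 3"
    using assms(1) by (simp_all add: markov_triple_def)
  show ?thesis
    using exhaust_3[of k] exhaust_3[of l] assms(2,3) pos
      *[of "v $ 1" "v $ 2" "v $ 3"] *[of "v $ 1" "v $ 3" "v $ 2"] *[of "v $ 2" "v $ 1" "v $ 3"]
      *[of "v $ 2" "v $ 3" "v $ 1"] *[of "v $ 3" "v $ 1" "v $ 2"] *[of "v $ 3" "v $ 2" "v $ 1"]
    by (auto simp: strict_max_at_def forall_3 markov_step_def Compl_singleton_3 sum_3 algebra_simps)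
qed

text \<open>The first letter 3 produces (1,1,3), the base case; afterwards each letter differs from
  its predecessor, hence from the position of the current maximum.\<close>

lemma strict_max_at_values_at:
  assumes "distinct_adj t" "t \<noteq> []" "hd t = 3"
  shows "strict_max_at (last t) (values_at t)"
  using assms
proof (induction t rule: rev_induct)
  case (snoc k t)
  show ?case
  proof (cases "t = []")
    case True
    with snoc.prems show ?thesis
      using values_at_snoc[of "[]" 3]
      by (simp add: strict_max_at_def forall_3 markov_step_def Compl_singleton_3 sum_3)
  next
    case False
    with snoc show ?thesis
      by (auto simp: values_at_snoc distinct_adj_append_iff
          intro!: strict_max_at_markov_step[where l = "last t"] markov_triple_values_at)
  qed
qed simp

lemma strict_max_at_unique: "strict_max_at k v \<Longrightarrow> strict_max_at l v \<Longrightarrow> k = l"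
  unfolding strict_max_at_def by (metis less_asym)

text \<open>The conditional hypotheses on \<open>hd\<close> pass to prefixes and admit the empty
  word, whose all-ones triple has no strict maximum. Otherwise equal maxima give equal last letters,
  and the involution strips them.\<close>

lemma values_at_inj:
  assumes "distinct_adj t" "t \<noteq> [] \<Longrightarrow> hd t = 3"
    and "distinct_adj u" "u \<noteq> [] \<Longrightarrow> hd u = 3"
    and "values_at t = values_at u"
  shows "t = u"
  using assms
proof (induction t arbitrary: u rule: rev_induct)
  case Nil
  have "\<not> strict_max_at k (values_at [])" for k
    using exhaust_3[of k] by (auto simp: strict_max_at_def forall_3)
  with Nil show ?case
    using strict_max_at_values_at[of u] by auto
next
  case (snoc k t)
  have max: "strict_max_at k (values_at (t @ [k]))"
    using strict_max_at_values_at[of "t @ [k]"] snoc.prems by simp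
  have "u \<noteq> []"
  proof
    assume "u = []"
    with max snoc.prems(5) exhaust_3[of k] show False
      by (auto simp: strict_max_at_def forall_3)
  qed
  then obtain u' l where u: "u = u' @ [l]"
    by (metis rev_exhaust)
  have "strict_max_at l (values_at (t @ [k]))"
    using strict_max_at_values_at[of u] snoc.prems u by simp
  with max have "k = l"
    by (rule strict_max_at_unique)
  with snoc.prems(5) u have "values_at t = values_at u'"
    by (metis values_at_snoc markov_step_involution)
  moreover have "t \<noteq> [] \<Longrightarrow> hd t = 3" "u' \<noteq> [] \<Longrightarrow> hd u' = 3"
    using snoc.prems(2,4) u by auto
  moreover have "distinct_adj t" "distinct_adj u'"
    using snoc.prems(1,3) u by auto
  ultimately have "t = u'"
    using snoc.IH by blast
  with u \<open>k = l\<close> show ?case by simp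
qed

definition triple :: "int ^ 3 \<Rightarrow> int \<times> int \<times> int" where
  "triple v = (v $ 1, v $ 2, v $ 3)"

lemma triple_eq_iff [simp]: "triple v = triple w \<longleftrightarrow> v = w"
  by (simp add: triple_def vec_eq_iff forall_3)

lemma triple_markov_step:
  "triple (markov_step 1 v) = (6 * v $ 2 * v $ 3 - v $ 1 - v $ 2 - v $ 3, v $ 2, v $ 3)"
  "triple (markov_step 2 v) = (v $ 1, 6 * v $ 1 * v $ 3 - v $ 1 - v $ 2 - v $ 3, v $ 3)"
  "triple (markov_step 3 v) = (v $ 1, v $ 2, 6 * v $ 1 * v $ 2 - v $ 1 - v $ 2 - v $ 3)"
  by (simp_all add: triple_def markov_step_def Compl_singleton_3 sum_3)

lemma triple_values_at_base:
  "triple (\<chi> i. 1) = (1, 1, 1)"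
  "triple (values_at [3]) = (1, 1, 3)"
  "triple (values_at [3, 2]) = (1, 13, 3)"
  using values_at_snoc[of "[]" 3] values_at_snoc[of "[3]" 2]
  by (simp_all add: triple_def markov_step_def Compl_singleton_3 sum_3)

section \<open>The subtree as a set of words\<close>

definition T3_vertices :: "3 list set" where
  "T3_vertices = {t. distinct_adj t \<and> (t = [] \<or> t = [3] \<or> (\<exists>s. t = 3 # 2 # s))}"

lemma T3_vertices_snocD:
  assumes "t @ [k] \<in> T3_vertices"
  shows "t \<in> T3_vertices"
proof -
  have "distinct_adj t"
    using assms by (auto simp: T3_vertices_def)
  then show ?thesis
    using assms by (cases t; cases "tl t") (auto simp: T3_vertices_def)
qed

lemma values_at_inj_on_T3:
  "\<lbrakk>t \<in> T3_vertices; u \<in> T3_vertices; values_at t = values_at u\<rbrakk> \<Longrightarrow> t = u"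
  by (rule values_at_inj) (auto simp: T3_vertices_def)

text \<open>The part of the tree beyond the edge from \<open>w\<close> to \<open>w @ [k]\<close> can
  be left only through \<open>w\<close>.\<close>

lemma path_stays_beyond_edge:
  assumes "successively (\<lambda>u u'. \<exists>k. tree_edge k u u') (v # p)"
    and "w \<notin> set p" "\<exists>s. v = w @ [k] @ s" "t \<in> set (v # p)"
  shows "\<exists>s. t = w @ [k] @ s"
  using assms
proof (induction p arbitrary: v)
  case (Cons v' p)
  from Cons.prems obtain s l where s: "v = w @ [k] @ s" and l: "tree_edge l v v'"
    by auto
  have "\<exists>s'. v' = w @ [k] @ s'"
  proof (cases "v' = v @ [l]")
    case False
    with l have v: "v = v' @ [l]" by (auto simp: tree_edge_def)
    \<comment> \<open>If \<open>s\<close> were empty, this step towards the root would arrive at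
      \<open>w\<close>, which the path avoids.\<close>
    with s have "s \<noteq> []"
      using Cons.prems by auto
    then show ?thesis
      using s v by (cases s rule: rev_cases) auto
  qed (use s in simp)
  with Cons.prems Cons.IH[of v'] show ?case
    by auto
qed auto

text \<open>The path runs through the intermediate prefixes, which are vertices and are told apart
  by their lengths.\<close>

lemma tree_path_prefixes:
  assumes "w @ s \<in> tree_vertices"
  shows "tree_path (map (\<lambda>i. w @ take i s) [0..<Suc (length s)]) w (w @ s)"
proof -
  have dist: "inj_on (\<lambda>i. w @ take i s) {0..<Suc (length s)}"
    by (rule inj_onI) (metis atLeastLessThan_iff length_take less_Suc_eq_le min.absorb2
        same_append_eq)
  have vert: "w @ take i s \<in> tree_vertices" for i
    using assms by (metis append.assoc append_take_drop_id distinct_adj_appendD1 mem_Collect_eq tree_vertices_def)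
  have "\<exists>k. tree_edge k (w @ take i s) (w @ take (Suc i) s)" if "i < length s" for i
    using that vert[of i] vert[of "Suc i"] by (auto simp: tree_edge_def take_Suc_conv_app_nth)
  then show ?thesis
    using dist vert
    by (auto simp: tree_path_def hd_map last_map distinct_map successively_conv_nth
        simp del: upt_Suc)
qed

lemma vertices_subtree_T3: "vertices subtree_T3 = T3_vertices"
proof -
  have "t \<in> T3_vertices" if t: "t \<in> tree_vertices" and p: "tree_path p [3] t" "[3, 2] \<in> set p" for t p
  proof -
    from p obtain q where q: "p = [3] # q"
      by (cases p) (auto simp: tree_path_def)
    with p obtain q1 q2 where q12: "q = q1 @ [3, 2] # q2"
      by (metis list.inject not_Cons_self2 set_ConsD split_list)
    \<comment> \<open>A path is distinct, so its start \<open>[3]\<close> does not recur and the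
      part from \<open>[3, 2]\<close> on cannot return across that edge.\<close>
    have q2: "successively (\<lambda>u u'. \<exists>k. tree_edge k u u') ([3, 2] # q2)" "[3] \<notin> set q2"
      "t \<in> set ([3, 2] # q2)"
      using p q q12 by (auto simp: tree_path_def successively_append_iff successively_Cons)
    have "\<exists>s. t = [3] @ [2] @ s"
      by (rule path_stays_beyond_edge[OF q2(1,2) _ q2(3)]) simp
    with t show ?thesis
      by (auto simp: T3_vertices_def tree_vertices_def)
  qed
  moreover have "\<exists>p. tree_path p [3] t \<and> [3, 2] \<in> set p" if t: "t \<in> tree_vertices" "t = 3 # 2 # s"
    for t s :: "3 list"
  proof -
    have "tree_path (map (\<lambda>i. [3] @ take i (2 # s)) [0..<Suc (length (2 # s))]) [3] ([3] @ 2 # s)"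
      by (rule tree_path_prefixes) (use t in simp)
    \<comment> \<open>The vertex \<open>[3, 2]\<close> is the prefix at index 1, right after the
      start.\<close>
    moreover have "[3, 2] \<in> set (map (\<lambda>i. [3] @ take i (2 # s)) [0..<Suc (length (2 # s))])"
      unfolding set_map by (rule image_eqI[of _ _ 1]) (simp_all add: less_Suc_eq_0_disj del: upt_Suc)
    ultimately show ?thesis using t by auto
  qed
  ultimately show ?thesis
    by (auto simp: subtree_T3_def T3_vertices_def tree_vertices_def)
qed

section \<open>Matching the branching rules with appended letters\<close>

lemma triple_child_markov_step:
  assumes "below (triple v)" "strict_max_at l v" "k \<noteq> l"
  shows "triple_child (triple v) (triple (markov_step k v))"
proof -
  have max: "v $ l = Max {v $ 1, v $ 2, v $ 3}"
    using assms(2) exhaust_3[of l] by (auto simp: strict_max_at_def forall_3 max_def)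
  have below: "below (v $ 1, v $ 2, v $ 3)"
    using assms(1) by (simp only: triple_def)
  from assms(3) consider "l = 1" "k = 2" | "l = 1" "k = 3" | "l = 2" "k = 1" | "l = 2" "k = 3"
    | "l = 3" "k = 1" | "l = 3" "k = 2"
    using exhaust_3[of k] exhaust_3[of l] by blast
  \<comment> \<open>Introduction rules 5 to 10 are the six branching rules, one for each pair of
    maximal and replaced position.\<close>
  then show ?thesis
    using triple_child_below.intros(5-10)[OF below] max
    by cases (simp_all only: triple_markov_step triple_def[of v])
qed

lemma T3_vertices_snoc_iff:
  assumes "3 # 2 # s \<in> T3_vertices"
  shows "(3 # 2 # s) @ [k] \<in> T3_vertices \<longleftrightarrow> k \<noteq> last (3 # 2 # s)"
proof -
  have "distinct_adj ((3 # 2 # s) @ [k]) \<longleftrightarrow> k \<noteq> last (3 # 2 # s)"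
    unfolding distinct_adj_append_iff using assms by (auto simp: T3_vertices_def)
  then show ?thesis
    by (auto simp: T3_vertices_def)
qed

lemma strict_max_at_T3:
  "t \<in> T3_vertices \<Longrightarrow> t \<noteq> [] \<Longrightarrow> strict_max_at (last t) (values_at t)"
  by (rule strict_max_at_values_at) (auto simp: T3_vertices_def)

lemma below_values_at: "3 # 2 # s \<in> T3_vertices \<Longrightarrow> below (triple (values_at (3 # 2 # s)))"
proof (induction s rule: rev_induct)
  case Nil
  show ?case unfolding append.simps triple_values_at_base by (rule triple_child_below.intros(3))
next
  case (snoc k s)
  let ?t = "3 # 2 # s"
  have t: "?t \<in> T3_vertices"
    by (rule T3_vertices_snocD[of _ k]) (use snoc.prems in simp)
  have "k \<noteq> last ?t"
    using T3_vertices_snoc_iff[OF t, of k] snoc.prems by simp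
  then have "triple_child (triple (values_at ?t)) (triple (values_at (?t @ [k])))"
    unfolding values_at_snoc
    by (intro triple_child_markov_step[OF snoc.IH[OF t] strict_max_at_T3[OF t]]) auto
  with snoc.IH[OF t] show ?case
    by (auto intro: triple_child_below.intros(4))
qed

lemma triple_child_values_at:
  assumes "t @ [k] \<in> T3_vertices"
  shows "triple_child (triple (values_at t)) (triple (values_at (t @ [k])))"
proof -
  consider "t = []" "k = 3" | "t = [3]" "k = 2" | s where "t = 3 # 2 # s"
    using assms by (cases t; cases "tl t") (auto simp: T3_vertices_def)
  then show ?thesis
  proof cases
    case 3
    have t: "t \<in> T3_vertices"
      using assms by (rule T3_vertices_snocD)
    have "k \<noteq> last t"
      using T3_vertices_snoc_iff[of s k] assms t 3 by simp
    then show ?thesis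
      unfolding values_at_snoc using t 3 below_values_at
      by (intro triple_child_markov_step[OF _ strict_max_at_T3]) auto
  qed (simp_all add: triple_values_at_base triple_child_below.intros(1,2))
qed

text \<open>The branching rules ask only for a maximum, possibly tied. For triples of words it is
  strict, so only the rules for the position of the last letter apply.\<close>

lemma T3_max_unique:
  assumes "t \<in> T3_vertices" "t \<noteq> []" "values_at t $ l = Max {values_at t $ 1, values_at t $ 2, values_at t $ 3}"
  shows "last t = l"
proof (rule ccontr)
  assume "last t \<noteq> l"
  then have "values_at t $ l < values_at t $ last t"
    using strict_max_at_T3[OF assms(1,2)] by (auto simp: strict_max_at_def)
  moreover have "values_at t $ last t \<le> Max {values_at t $ 1, values_at t $ 2, values_at t $ 3}"
    using exhaust_3[of "last t"] by (intro Max_ge) auto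
  ultimately show False
    using assms(3) by linarith
qed

text \<open>A common form of the six branching rules: replacing position \<open>k\<close> appends
  the letter \<open>k\<close>, which is legal because the last letter is the maximal position
  \<open>l\<close>.\<close>

lemma child_from_max:
  assumes "3 # 2 # s \<in> T3_vertices" "triple (values_at (3 # 2 # s)) = (a, b, c)"
    and "vector [a, b, c] $ l = Max {a, b, c}" "k \<noteq> l"
  shows "\<exists>u k'. u @ [k'] \<in> T3_vertices \<and> (a, b, c) = triple (values_at u) \<and>
    triple (markov_step k (vector [a, b, c])) = triple (values_at (u @ [k']))"
proof -
  let ?t = "3 # 2 # s"
  have v: "values_at ?t = vector [a, b, c]"
    using assms(2) by (simp add: triple_def vec_eq_iff forall_3)
  have "last ?t = l"
    by (rule T3_max_unique) (use assms v in auto)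
  then have "?t @ [k] \<in> T3_vertices"
    using T3_vertices_snoc_iff[OF assms(1), of k] assms(4) by simp
  with assms(2) v show ?thesis
    by (metis values_at_snoc)
qed

text \<open>Simultaneous rule induction, as the two predicates are mutually inductive; the claim for
  \<open>below\<close> supplies the word from which a branching rule starts.\<close>

lemma triple_child_imp:
  "triple_child v w \<Longrightarrow>
    \<exists>u k. u @ [k] \<in> T3_vertices \<and> v = triple (values_at u) \<and> w = triple (values_at (u @ [k]))"
  "below v \<Longrightarrow> \<exists>s. 3 # 2 # s \<in> T3_vertices \<and> v = triple (values_at (3 # 2 # s))"
proof (induction rule: triple_child_below.inducts)
  case 1
  show ?case
    by (intro exI[of _ "[]"] exI[of _ 3]) (simp add: triple_values_at_base T3_vertices_def)
next
  case 2
  show ?case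
    by (intro exI[of _ "[3]"] exI[of _ 2]) (simp add: triple_values_at_base T3_vertices_def)
next
  case 3
  show ?case
    by (intro exI[of _ "[]"]) (simp add: triple_values_at_base T3_vertices_def)
next
  case (4 v w)
  then obtain s u k where s: "3 # 2 # s \<in> T3_vertices" "v = triple (values_at (3 # 2 # s))"
    and u: "u @ [k] \<in> T3_vertices" "v = triple (values_at u)" "w = triple (values_at (u @ [k]))"
    by blast
  \<comment> \<open>The two induction hypotheses give two words for \<open>v\<close>. Injectivity
    identifies them, so the word of \<open>w\<close> also begins with 3, 2.\<close>
  have "u \<in> T3_vertices"
    using u(1) by (rule T3_vertices_snocD)
  with s u have "u = 3 # 2 # s"
    by (intro values_at_inj_on_T3) auto
  with u show ?case by auto
next
  case (5 a b c)
  then show ?case using child_from_max[of _ a b c 1 2] by (auto simp: triple_markov_step)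
next
  case (6 a b c)
  then show ?case using child_from_max[of _ a b c 1 3] by (auto simp: triple_markov_step)
next
  case (7 a b c)
  then show ?case using child_from_max[of _ a b c 2 1] by (auto simp: triple_markov_step)
next
  case (8 a b c)
  then show ?case using child_from_max[of _ a b c 2 3] by (auto simp: triple_markov_step)
next
  case (9 a b c)
  then show ?case using child_from_max[of _ a b c 3 1] by (auto simp: triple_markov_step)
next
  case (10 a b c)
  then show ?case using child_from_max[of _ a b c 3 2] by (auto simp: triple_markov_step)
qed

lemma vertices_triple_tree: "vertices triple_tree = (\<lambda>t. triple (values_at t)) ` T3_vertices"
proof -
  have "v \<in> (\<lambda>t. triple (values_at t)) ` T3_vertices" if "triple_child\<^sup>*\<^sup>* (1, 1, 1) v" for v
    using that
  proof induction
    case base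
    have "[] \<in> T3_vertices" by (simp add: T3_vertices_def)
    then show ?case using triple_values_at_base(1) by force
  next
    case (step v w)
    then show ?case using triple_child_imp(1) by blast
  qed
  moreover have "t \<in> T3_vertices \<Longrightarrow> triple_child\<^sup>*\<^sup>* (1, 1, 1) (triple (values_at t))" for t
  proof (induction t rule: rev_induct)
    case Nil
    show ?case by (simp add: triple_values_at_base)
  next
    case (snoc k t)
    then show ?case
      using T3_vertices_snocD triple_child_values_at by (metis rtranclp.rtrancl_into_rtrancl)
  qed
  ultimately show ?thesis
    by (auto simp: triple_tree_def)
qed

theorem theorem3p2:
  shows "\<exists>\<phi>. rooted_tree_iso subtree_T3 triple_tree \<phi> \<and>
    (\<forall>t\<in>vertices subtree_T3.
       cluster_value_at_1 (cluster_at (\<chi> i. 2) (indeterminates, \<Delta>) t) (\<phi> t))"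
proof (intro exI conjI)
  let ?\<phi> = "\<lambda>t. triple (values_at t)"
  have "child subtree_T3 t u \<longleftrightarrow> child triple_tree (?\<phi> t) (?\<phi> u)"
    if tu: "t \<in> T3_vertices" "u \<in> T3_vertices" for t u
  proof
    assume "child subtree_T3 t u"
    then show "child triple_tree (?\<phi> t) (?\<phi> u)"
      using tu triple_child_values_at by (auto simp: subtree_T3_def triple_tree_def)
  next
    assume "child triple_tree (?\<phi> t) (?\<phi> u)"
    then have "triple_child (?\<phi> t) (?\<phi> u)"
      by (simp add: triple_tree_def)
    \<comment> \<open>An edge between the images comes from some edge of the subtree; injectivity
      shows that its endpoints are \<open>t\<close> and \<open>u\<close> themselves.\<close>
    from triple_child_imp(1)[OF this] obtain t' k
      where t': "t' @ [k] \<in> T3_vertices" "?\<phi> t = ?\<phi> t'" "?\<phi> u = ?\<phi> (t' @ [k])"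
      by blast
    have "t = t'"
      using t'(2) by (intro values_at_inj_on_T3[OF tu(1) T3_vertices_snocD[OF t'(1)]]) simp
    moreover have "u = t' @ [k]"
      using t'(3) by (intro values_at_inj_on_T3[OF tu(2) t'(1)]) simp
    ultimately show "child subtree_T3 t u"
      by (simp add: subtree_T3_def)
  qed
  moreover have "inj_on ?\<phi> T3_vertices"
    by (rule inj_onI) (simp add: values_at_inj_on_T3)
  moreover have "?\<phi> (root_vertex subtree_T3) = root_vertex triple_tree"
    by (simp add: subtree_T3_def triple_tree_def triple_values_at_base)
  ultimately show "rooted_tree_iso subtree_T3 triple_tree ?\<phi>"
    unfolding rooted_tree_iso_def vertices_subtree_T3 vertices_triple_tree bij_betw_def
    by blast
  show "\<forall>t\<in>vertices subtree_T3.
      cluster_value_at_1 (cluster_at (\<chi> i. 2) (indeterminates, \<Delta>) t) (?\<phi> t)"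
    unfolding vertices_subtree_T3
    by (auto simp: cluster_at_def cluster_pattern_eq cluster_value_at_1_def triple_def
        T3_vertices_def tree_vertices_def intro: seed_at_values)
qed

end
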